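(* Let $G$ and $H$ be sequent calculi such that $H$ extends $\mathbf{MALL}$ and $H$ is an axiomatic extension of $G$ by $\mathrm{MPF}$ rules. If $G$ has $H$-monotone feasible interpolation, then so does $H$.
   Context: Language: classical propositional language with fusion, addition, $1$, $0$ read as $\wedge,\vee,\top,\bot$; $V(\cdot)$ = atoms (for meta-formulas also formula variables). Multi-conclusion sequents $\Gamma\Rightarrow\Delta$ with finite multisets; rules are schemes over meta-formulas and meta-multiset variables. $\mathbf{MALL}$: multi-conclusion calculus with axioms $\phi\Rightarrow\phi$, $\Rightarrow1$, $0\Rightarrow$, $\Gamma\Rightarrow\top,\Delta$, $\Gamma,\bot\Rightarrow\Delta$ and the standard multi-conclusion rules for $1,0,\wedge,\vee,*,+$; $H$ extends $\mathbf{MALL}$ if every $\mathbf{MALL}$-provable sequent is $H$-provable. $H$ is an axiomatic extension of $G$ by rules $R$ if $H$ consists of all $G$-provable sequents as axioms together with the rules $R$. Focused rules: left: premises $\Gamma_i,\bar\phi_{ir}\Rightarrow\Delta_i$, conclusion $\Gamma_1,\dots,\Gamma_n,\phi\Rightarrow\Delta_1,\dots,\Delta_n$; right: premises $\Gamma_i\Rightarrow\bar\phi_{ir},\Delta_i$, conclusion $\Gamma_1,\dots,\Gamma_n\Rightarrow\Delta_1,\dots,\Delta_n,\phi$; $\Gamma_i,\Delta_i$ meta-multiset variables and all variables of $\bar\phi_{ir}$ in $V(\phi)$. A formula is monotone if all atom occurrences are positive (not under negation nor in the antecedent of an implication); a multiset is monotone if all its elements are. A focused rule is $\mathrm{MPF}$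 if whenever the antecedent of the conclusion is monotone, the antecedents of all premises are monotone. $G$ has $H$-monotone feasible interpolation if for every $k$ and every sequent $\Sigma\Rightarrow\Lambda_1,\dots,\Lambda_k$ with a tree-like $G$-proof $\pi$ there are $C_1,\dots,C_k$ with $|C_j|\le|\pi|^{O(1)}$, $H\vdash\Sigma\Rightarrow C_1,\dots,C_k$, $H\vdash C_j\Rightarrow\Lambda_j$, $V(C_j)\subseteq V(\Sigma)\cap V(\Lambda_j)$, and each $C_j$ monotone whenever $\Sigma$ is monotone (and likewise for $H$ in place of $G$).
   Formalization: "H extends MALL" is taken to mean that the MALL axioms are provable and the MALL rules admissible in H (mere inclusion of provable sequents makes the claim false), and the size of an H-proof counts the G-proofs of the G-provable sequents used as axioms. *)

theory Defs
  imports "HOL-Library.Multiset"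
begin

datatype 'v fm =
    Atom 'v
  | Top
  | Bot
  | Neg "'v fm"
  | And "'v fm" "'v fm"
  | Or "'v fm" "'v fm"
  | Imp "'v fm" "'v fm"

abbreviation Fusion :: "'v fm \<Rightarrow> 'v fm \<Rightarrow> 'v fm" where "Fusion \<equiv> And"
abbreviation Addition :: "'v fm \<Rightarrow> 'v fm \<Rightarrow> 'v fm" where "Addition \<equiv> Or"
abbreviation One :: "'v fm" where "One \<equiv> Top"
abbreviation Zero :: "'v fm" where "Zero \<equiv> Bot"

abbreviation vars :: "'v fm \<Rightarrow> 'v set" where "vars \<equiv> set_fm"

definition vars_mset :: "'v fm multiset \<Rightarrow> 'v set" where
  "vars_mset \<Gamma> = (\<Union>A\<in>set_mset \<Gamma>. vars A)"

primrec fsize :: "'v fm \<Rightarrow> nat" where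
  "fsize (Atom v) = 1"
| "fsize Top = 1"
| "fsize Bot = 1"
| "fsize (Neg A) = fsize A + 1"
| "fsize (And A B) = fsize A + fsize B + 1"
| "fsize (Or A B) = fsize A + fsize B + 1"
| "fsize (Imp A B) = fsize A + fsize B + 1"

primrec monotone_fm :: "'v fm \<Rightarrow> bool" where
  "monotone_fm (Atom v) = True"
| "monotone_fm Top = True"
| "monotone_fm Bot = True"
| "monotone_fm (Neg A) = (vars A = {})"
| "monotone_fm (And A B) = (monotone_fm A \<and> monotone_fm B)"
| "monotone_fm (Or A B) = (monotone_fm A \<and> monotone_fm B)"
| "monotone_fm (Imp A B) = (vars A = {} \<and> monotone_fm B)"

definition monotone_mset :: "'v fm multiset \<Rightarrow> bool" where
  "monotone_mset \<Gamma> = (\<forall>A\<in>#\<Gamma>. monotone_fm A)"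

type_synonym form = "nat fm"
type_synonym sequent = "form multiset \<times> form multiset"

text \<open>Meta-formulas are built from atoms and formula variables; a meta-multiset
  consists of meta-formulas and meta-multiset variables.\<close>

datatype mvar = At nat | FVar nat
type_synonym mform = "mvar fm"
datatype mitem = F mform | M nat
type_synonym msequent = "mitem multiset \<times> mitem multiset"
type_synonym rule = "msequent multiset \<times> msequent"  \<comment> \<open>premises, conclusion\<close>

primrec subst :: "(nat \<Rightarrow> form) \<Rightarrow> mform \<Rightarrow> form" where
  "subst \<sigma> (Atom v) = (case v of At p \<Rightarrow> Atom p | FVar x \<Rightarrow> \<sigma> x)"
| "subst \<sigma> Top = Top"
| "subst \<sigma> Bot = Bot"
| "subst \<sigma> (Neg A) = Neg (subst \<sigma> A)"
| "subst \<sigma> (And A B) = And (subst \<sigma> A) (subst \<sigma> B)"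
| "subst \<sigma> (Or A B) = Or (subst \<sigma> A) (subst \<sigma> B)"
| "subst \<sigma> (Imp A B) = Imp (subst \<sigma> A) (subst \<sigma> B)"

primrec inst_item :: "(nat \<Rightarrow> form) \<Rightarrow> (nat \<Rightarrow> form multiset) \<Rightarrow> mitem \<Rightarrow> form multiset" where
  "inst_item \<sigma> \<tau> (F A) = {#subst \<sigma> A#}"
| "inst_item \<sigma> \<tau> (M x) = \<tau> x"

definition inst_mset :: "(nat \<Rightarrow> form) \<Rightarrow> (nat \<Rightarrow> form multiset) \<Rightarrow> mitem multiset \<Rightarrow> form multiset" where
  "inst_mset \<sigma> \<tau> X = (\<Sum>i\<in>#X. inst_item \<sigma> \<tau> i)"

definition inst :: "(nat \<Rightarrow> form) \<Rightarrow> (nat \<Rightarrow> form multiset) \<Rightarrow> msequent \<Rightarrow> sequent" where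
  "inst \<sigma> \<tau> S = (inst_mset \<sigma> \<tau> (fst S), inst_mset \<sigma> \<tau> (snd S))"

definition instance_of :: "rule \<Rightarrow> sequent multiset \<Rightarrow> sequent \<Rightarrow> bool" where
  "instance_of r Ps S = (\<exists>\<sigma> \<tau>. Ps = image_mset (inst \<sigma> \<tau>) (fst r) \<and> S = inst \<sigma> \<tau> (snd r))"

datatype ptree = Node (root: sequent) (subproofs: "ptree list")

definition seq_size :: "sequent \<Rightarrow> nat" where
  "seq_size S = (\<Sum>A\<in>#fst S. fsize A) + (\<Sum>A\<in>#snd S. fsize A) + 1"

primrec proof_size :: "ptree \<Rightarrow> nat" where
  "proof_size (Node S ts) = seq_size S + sum_list (map proof_size ts)"

text \<open>\<open>AxExt G R\<close> is the axiomatic extension of \<open>G\<close> by the rules \<open>R\<close>: its axioms are all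
  \<open>G\<close>-provable sequents, but the \<open>G\<close>-rules are not available below an \<open>R\<close>-inference.
  An axiom enters a proof together with a \<open>G\<close>-proof witnessing it, so the size of that
  \<open>G\<close>-proof is part of the size of the proof.\<close>

datatype calculus = Calc "rule set" | AxExt calculus "rule set"

inductive is_proof :: "calculus \<Rightarrow> ptree \<Rightarrow> bool" where
  calc_rule: "\<lbrakk>r \<in> R; instance_of r (mset (map root ts)) S; \<forall>t\<in>set ts. is_proof (Calc R) t\<rbrakk>
     \<Longrightarrow> is_proof (Calc R) (Node S ts)"
| ext_axiom: "is_proof G t \<Longrightarrow> is_proof (AxExt G R) t"
| ext_rule: "\<lbrakk>r \<in> R; instance_of r (mset (map root ts)) S; \<forall>t\<in>set ts. is_proof (AxExt G R) t\<rbrakk>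
     \<Longrightarrow> is_proof (AxExt G R) (Node S ts)"

definition provable :: "calculus \<Rightarrow> sequent \<Rightarrow> bool" where
  "provable G S = (\<exists>\<pi>. is_proof G \<pi> \<and> root \<pi> = S)"

definition axiomatic_extension :: "calculus \<Rightarrow> calculus \<Rightarrow> rule set \<Rightarrow> bool" where
  "axiomatic_extension H G R = (H = AxExt G R)"

inductive derivable_from :: "rule set \<Rightarrow> sequent set \<Rightarrow> sequent \<Rightarrow> bool" for R X where
  hyp: "S \<in> X \<Longrightarrow> derivable_from R X S"
| step: "\<lbrakk>r \<in> R; instance_of r Ps S; \<forall>P\<in>#Ps. derivable_from R X P\<rbrakk> \<Longrightarrow> derivable_from R X S"

text \<open>Extension is closure under provability: whatever the rules \<open>K\<close> prove, starting from
  sequents provable in \<open>H\<close>, is provable in \<open>H\<close>. Equivalently, the axioms in \<open>K\<close> are provable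
  and the rules in \<open>K\<close> admissible in \<open>H\<close>. Inclusion of the sets of provable sequents would be
  too weak: \<open>H\<close> need not have any rule for combining interpolants.\<close>

definition extends :: "calculus \<Rightarrow> rule set \<Rightarrow> bool" where
  "extends H K = (\<forall>S. derivable_from K {T. provable H T} S \<longrightarrow> provable H S)"

abbreviation (input) "mphi \<equiv> (Atom (FVar 0) :: mform)"
abbreviation (input) "mpsi \<equiv> (Atom (FVar 1) :: mform)"
abbreviation (input) "mGam \<equiv> M 0"
abbreviation (input) "mDel \<equiv> M 1"
abbreviation (input) "mPi \<equiv> M 2"
abbreviation (input) "mLam \<equiv> M 3"

definition MALL :: "rule set" where
  "MALL = {
    ({#}, ({#F mphi#}, {#F mphi#})),
    ({#}, ({#}, {#F One#})),
    ({#}, ({#F Zero#}, {#})),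
    ({#}, ({#mGam#}, {#F Top, mDel#})),
    ({#}, ({#mGam, F Bot#}, {#mDel#})),
    ({#({#mGam#}, {#mDel#})#}, ({#mGam, F One#}, {#mDel#})),
    ({#({#mGam#}, {#mDel#})#}, ({#mGam#}, {#F Zero, mDel#})),
    ({#({#mGam, F mphi#}, {#mDel#})#}, ({#mGam, F (And mphi mpsi)#}, {#mDel#})),
    ({#({#mGam, F mpsi#}, {#mDel#})#}, ({#mGam, F (And mphi mpsi)#}, {#mDel#})),
    ({#({#mGam#}, {#F mphi, mDel#}), ({#mGam#}, {#F mpsi, mDel#})#},
      ({#mGam#}, {#F (And mphi mpsi), mDel#})),
    ({#({#mGam, F mphi#}, {#mDel#}), ({#mGam, F mpsi#}, {#mDel#})#},
      ({#mGam, F (Or mphi mpsi)#}, {#mDel#})),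
    ({#({#mGam#}, {#F mphi, mDel#})#}, ({#mGam#}, {#F (Or mphi mpsi), mDel#})),
    ({#({#mGam#}, {#F mpsi, mDel#})#}, ({#mGam#}, {#F (Or mphi mpsi), mDel#})),
    ({#({#mGam, F mphi, F mpsi#}, {#mDel#})#}, ({#mGam, F (Fusion mphi mpsi)#}, {#mDel#})),
    ({#({#mGam#}, {#F mphi, mDel#}), ({#mPi#}, {#F mpsi, mLam#})#},
      ({#mGam, mPi#}, {#F (Fusion mphi mpsi), mDel, mLam#})),
    ({#({#mGam, F mphi#}, {#mDel#}), ({#mPi, F mpsi#}, {#mLam#})#},
      ({#mGam, mPi, F (Addition mphi mpsi)#}, {#mDel, mLam#})),
    ({#({#mGam#}, {#F mphi, F mpsi, mDel#})#}, ({#mGam#}, {#F (Addition mphi mpsi), mDel#}))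
  }"

text \<open>In the focused rules, \<open>\<Gamma> i\<close> and \<open>\<Delta> i\<close> (\<open>i < n\<close>) are pairwise distinct meta-multiset
  variables, and \<open>\<Phi> i\<close> collects the multisets of active formulas of the premises that share the
  context \<open>\<Gamma> i\<close>, \<open>\<Delta> i\<close>.\<close>

definition distinct_contexts :: "nat \<Rightarrow> (nat \<Rightarrow> nat) \<Rightarrow> (nat \<Rightarrow> nat) \<Rightarrow> bool" where
  "distinct_contexts n \<Gamma> \<Delta> =
    (inj_on \<Gamma> {..<n} \<and> inj_on \<Delta> {..<n} \<and> \<Gamma> ` {..<n} \<inter> \<Delta> ` {..<n} = {})"

definition left_focused :: "rule \<Rightarrow> bool" where
  "left_focused r = (\<exists>n \<Gamma> \<Delta> (\<Phi> :: nat \<Rightarrow> mform multiset multiset) \<phi>.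
     distinct_contexts n \<Gamma> \<Delta> \<and>
     (\<forall>i<n. \<forall>X\<in>#\<Phi> i. vars_mset X \<subseteq> vars \<phi>) \<and>
     r = (\<Sum>i<n. image_mset (\<lambda>X. (add_mset (M (\<Gamma> i)) (image_mset F X), {#M (\<Delta> i)#})) (\<Phi> i),
          (add_mset (F \<phi>) (\<Sum>i<n. {#M (\<Gamma> i)#}), \<Sum>i<n. {#M (\<Delta> i)#})))"

definition right_focused :: "rule \<Rightarrow> bool" where
  "right_focused r = (\<exists>n \<Gamma> \<Delta> (\<Phi> :: nat \<Rightarrow> mform multiset multiset) \<phi>.
     distinct_contexts n \<Gamma> \<Delta> \<and>
     (\<forall>i<n. \<forall>X\<in>#\<Phi> i. vars_mset X \<subseteq> vars \<phi>) \<and>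
     r = (\<Sum>i<n. image_mset (\<lambda>X. ({#M (\<Gamma> i)#}, add_mset (M (\<Delta> i)) (image_mset F X))) (\<Phi> i),
          (\<Sum>i<n. {#M (\<Gamma> i)#}, add_mset (F \<phi>) (\<Sum>i<n. {#M (\<Delta> i)#}))))"

definition focused :: "rule \<Rightarrow> bool" where
  "focused r = (left_focused r \<or> right_focused r)"

definition MPF :: "rule \<Rightarrow> bool" where
  "MPF r = (focused r \<and>
     (\<forall>Ps S. instance_of r Ps S \<longrightarrow> monotone_mset (fst S) \<longrightarrow> (\<forall>P\<in>#Ps. monotone_mset (fst P))))"

text \<open>\<open>monotone_feasible_interpolation G H\<close>: the calculus \<open>G\<close> has \<open>H\<close>-monotone feasible
  interpolation. The exponent \<open>c\<close> depends on \<open>G\<close> and \<open>H\<close> only.\<close>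

definition monotone_feasible_interpolation :: "calculus \<Rightarrow> calculus \<Rightarrow> bool" where
  "monotone_feasible_interpolation G H = (\<exists>c::nat. \<forall>(k::nat) \<Sigma> (\<Lambda> :: nat \<Rightarrow> form multiset) \<pi>.
     is_proof G \<pi> \<and> root \<pi> = (\<Sigma>, \<Sum>j<k. \<Lambda> j) \<longrightarrow>
     (\<exists>C :: nat \<Rightarrow> form.
        provable H (\<Sigma>, \<Sum>j<k. {#C j#}) \<and>
        (\<forall>j<k. fsize (C j) \<le> proof_size \<pi> ^ c \<and>
               provable H ({#C j#}, \<Lambda> j) \<and>
               vars (C j) \<subseteq> vars_mset \<Sigma> \<inter> vars_mset (\<Lambda> j) \<and>
               (monotone_mset \<Sigma> \<longrightarrow> monotone_fm (C j)))))"

end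

theory Submission
  imports Defs
begin

text \<open>Induction on the \<open>H\<close>-proof. At a focused inference the partition \<open>\<Lambda>\<close> of the succedent induces
  partitions of the contexts \<open>\<Delta> i\<close>, and the active formulas join the part containing the principal
  formula \<open>\<phi>\<close>, if \<open>\<phi>\<close> is on the right. The interpolants of premises sharing a context are combined
  additively, the results for different contexts multiplicatively: by disjunction and addition in the
  parts not containing \<open>\<phi>\<close>, by conjunction and fusion in the part containing \<open>\<phi>\<close>. Since the contexts
  of a focused rule are arbitrary, the same rule applies to the interpolants. The size recurrence is a
  sum over the premises, which a fixed exponent absorbs.\<close>

section \<open>Derived rules of calculi extending MALL\<close>

text \<open>Fusion and addition abbreviate conjunction and disjunction, so one iterated formula
  obeys the additive and the multiplicative rules alike. The final \<open>Bot\<close>, kept also for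
  nonempty lists, lets arbitrary side formulas be absorbed.\<close>

definition bigOr :: "'v fm list \<Rightarrow> 'v fm" where
  "bigOr As = foldr Or As Bot"

definition bigAnd :: "'v fm list \<Rightarrow> 'v fm" where
  "bigAnd As = foldr And As Top"

lemma bigOr_simps [simp]: "bigOr [] = Bot" "bigOr (A # As) = Or A (bigOr As)"
  by (simp_all add: bigOr_def)

lemma bigAnd_simps [simp]: "bigAnd [] = Top" "bigAnd (A # As) = And A (bigAnd As)"
  by (simp_all add: bigAnd_def)

lemma vars_bigOr [simp]: "vars (bigOr As) = (\<Union>A\<in>set As. vars A)"
  by (induction As) auto

lemma vars_bigAnd [simp]: "vars (bigAnd As) = (\<Union>A\<in>set As. vars A)"
  by (induction As) auto

lemma monotone_bigOr [simp]: "monotone_fm (bigOr As) \<longleftrightarrow> (\<forall>A\<in>set As. monotone_fm A)"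
  by (induction As) auto

lemma monotone_bigAnd [simp]: "monotone_fm (bigAnd As) \<longleftrightarrow> (\<forall>A\<in>set As. monotone_fm A)"
  by (induction As) auto

lemma fsize_bigOr: "fsize (bigOr As) = 1 + (\<Sum>A\<leftarrow>As. fsize A + 1)"
  by (induction As) auto

lemma fsize_bigAnd: "fsize (bigAnd As) = 1 + (\<Sum>A\<leftarrow>As. fsize A + 1)"
  by (induction As) auto

locale MALL_extension =
  fixes H :: calculus
  assumes extends_MALL: "extends H MALL"
begin

text \<open>\<open>extends\<close> closes provability under whole derivations from provable
  sequents; a derivation of one step gives the admissibility of each rule.\<close>

lemma MALL_rule:
  assumes "r \<in> MALL" and "\<forall>P\<in>#fst r. provable H (inst \<sigma> \<tau> P)"
  shows "provable H (inst \<sigma> \<tau> (snd r))"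
proof -
  have "derivable_from MALL {T. provable H T} (inst \<sigma> \<tau> (snd r))"
    by (rule derivable_from.step[of r _ "image_mset (inst \<sigma> \<tau>) (fst r)"])
      (use assms in \<open>auto simp: instance_of_def intro: derivable_from.hyp\<close>)
  then show ?thesis
    using extends_MALL unfolding extends_def by blast
qed

section \<open>The single rules of MALL as closure properties of provability\<close>

lemma top_right: "provable H (\<Gamma>, add_mset Top \<Delta>)"
  using MALL_rule[of "({#}, ({#mGam#}, {#F Top, mDel#}))" "\<lambda>_. Top" "\<lambda>x. if x = 0 then \<Gamma> else \<Delta>"]
  by (simp add: inst_def inst_mset_def MALL_def)

lemma bot_left: "provable H (add_mset Bot \<Gamma>, \<Delta>)"
  using MALL_rule[of "({#}, ({#mGam, F Bot#}, {#mDel#}))" "\<lambda>_. Top" "\<lambda>x. if x = 0 then \<Gamma> else \<Delta>"]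
  by (simp add: inst_def inst_mset_def MALL_def)

lemma one_left:
  assumes "provable H (\<Gamma>, \<Delta>)"
  shows "provable H (add_mset One \<Gamma>, \<Delta>)"
  using assms MALL_rule[of "({#({#mGam#}, {#mDel#})#}, ({#mGam, F One#}, {#mDel#}))"
      "\<lambda>_. Top" "\<lambda>x. if x = 0 then \<Gamma> else \<Delta>"]
  by (simp add: inst_def inst_mset_def MALL_def)

lemma zero_right:
  assumes "provable H (\<Gamma>, \<Delta>)"
  shows "provable H (\<Gamma>, add_mset Zero \<Delta>)"
  using assms MALL_rule[of "({#({#mGam#}, {#mDel#})#}, ({#mGam#}, {#F Zero, mDel#}))"
      "\<lambda>_. Top" "\<lambda>x. if x = 0 then \<Gamma> else \<Delta>"]
  by (simp add: inst_def inst_mset_def MALL_def)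

lemma and_left1:
  assumes "provable H (add_mset A \<Gamma>, \<Delta>)"
  shows "provable H (add_mset (And A B) \<Gamma>, \<Delta>)"
  using assms MALL_rule[of "({#({#mGam, F mphi#}, {#mDel#})#}, ({#mGam, F (And mphi mpsi)#}, {#mDel#}))"
      "\<lambda>x. if x = 0 then A else B" "\<lambda>x. if x = 0 then \<Gamma> else \<Delta>"]
  by (simp add: inst_def inst_mset_def MALL_def)

lemma and_left2:
  assumes "provable H (add_mset B \<Gamma>, \<Delta>)"
  shows "provable H (add_mset (And A B) \<Gamma>, \<Delta>)"
  using assms MALL_rule[of "({#({#mGam, F mpsi#}, {#mDel#})#}, ({#mGam, F (And mphi mpsi)#}, {#mDel#}))"
      "\<lambda>x. if x = 0 then A else B" "\<lambda>x. if x = 0 then \<Gamma> else \<Delta>"]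
  by (simp add: inst_def inst_mset_def MALL_def)

lemma and_right:
  assumes "provable H (\<Gamma>, add_mset A \<Delta>)" "provable H (\<Gamma>, add_mset B \<Delta>)"
  shows "provable H (\<Gamma>, add_mset (And A B) \<Delta>)"
  using assms MALL_rule[of "({#({#mGam#}, {#F mphi, mDel#}), ({#mGam#}, {#F mpsi, mDel#})#},
      ({#mGam#}, {#F (And mphi mpsi), mDel#}))"
      "\<lambda>x. if x = 0 then A else B" "\<lambda>x. if x = 0 then \<Gamma> else \<Delta>"]
  by (simp add: inst_def inst_mset_def MALL_def)

lemma or_left:
  assumes "provable H (add_mset A \<Gamma>, \<Delta>)" "provable H (add_mset B \<Gamma>, \<Delta>)"
  shows "provable H (add_mset (Or A B) \<Gamma>, \<Delta>)"
  using assms MALL_rule[of "({#({#mGam, F mphi#}, {#mDel#}), ({#mGam, F mpsi#}, {#mDel#})#},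
      ({#mGam, F (Or mphi mpsi)#}, {#mDel#}))"
      "\<lambda>x. if x = 0 then A else B" "\<lambda>x. if x = 0 then \<Gamma> else \<Delta>"]
  by (simp add: inst_def inst_mset_def MALL_def)

lemma or_right1:
  assumes "provable H (\<Gamma>, add_mset A \<Delta>)"
  shows "provable H (\<Gamma>, add_mset (Or A B) \<Delta>)"
  using assms MALL_rule[of "({#({#mGam#}, {#F mphi, mDel#})#}, ({#mGam#}, {#F (Or mphi mpsi), mDel#}))"
      "\<lambda>x. if x = 0 then A else B" "\<lambda>x. if x = 0 then \<Gamma> else \<Delta>"]
  by (simp add: inst_def inst_mset_def MALL_def)

lemma or_right2:
  assumes "provable H (\<Gamma>, add_mset B \<Delta>)"
  shows "provable H (\<Gamma>, add_mset (Or A B) \<Delta>)"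
  using assms MALL_rule[of "({#({#mGam#}, {#F mpsi, mDel#})#}, ({#mGam#}, {#F (Or mphi mpsi), mDel#}))"
      "\<lambda>x. if x = 0 then A else B" "\<lambda>x. if x = 0 then \<Gamma> else \<Delta>"]
  by (simp add: inst_def inst_mset_def MALL_def)

lemma fusion_left:
  assumes "provable H (add_mset A (add_mset B \<Gamma>), \<Delta>)"
  shows "provable H (add_mset (Fusion A B) \<Gamma>, \<Delta>)"
  using assms MALL_rule[of "({#({#mGam, F mphi, F mpsi#}, {#mDel#})#}, ({#mGam, F (Fusion mphi mpsi)#}, {#mDel#}))"
      "\<lambda>x. if x = 0 then A else B" "\<lambda>x. if x = 0 then \<Gamma> else \<Delta>"]
  by (simp add: inst_def inst_mset_def MALL_def add_mset_commute)

lemma fusion_right: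
  assumes "provable H (\<Gamma>, add_mset A \<Delta>)" "provable H (\<Pi>, add_mset B \<Lambda>)"
  shows "provable H (\<Gamma> + \<Pi>, add_mset (Fusion A B) (\<Delta> + \<Lambda>))"
  using assms MALL_rule[of "({#({#mGam#}, {#F mphi, mDel#}), ({#mPi#}, {#F mpsi, mLam#})#},
      ({#mGam, mPi#}, {#F (Fusion mphi mpsi), mDel, mLam#}))"
      "\<lambda>x. if x = 0 then A else B"
      "\<lambda>x. if x = 0 then \<Gamma> else if x = 1 then \<Delta> else if x = 2 then \<Pi> else \<Lambda>"]
  by (simp add: inst_def inst_mset_def MALL_def)

lemma addition_left:
  assumes "provable H (add_mset A \<Gamma>, \<Delta>)" "provable H (add_mset B \<Pi>, \<Lambda>)"
  shows "provable H (add_mset (Addition A B) (\<Gamma> + \<Pi>), \<Delta> + \<Lambda>)"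
  using assms MALL_rule[of "({#({#mGam, F mphi#}, {#mDel#}), ({#mPi, F mpsi#}, {#mLam#})#},
      ({#mGam, mPi, F (Addition mphi mpsi)#}, {#mDel, mLam#}))"
      "\<lambda>x. if x = 0 then A else B"
      "\<lambda>x. if x = 0 then \<Gamma> else if x = 1 then \<Delta> else if x = 2 then \<Pi> else \<Lambda>"]
  by (simp add: inst_def inst_mset_def MALL_def)

lemma addition_right:
  assumes "provable H (\<Gamma>, add_mset A (add_mset B \<Delta>))"
  shows "provable H (\<Gamma>, add_mset (Addition A B) \<Delta>)"
  using assms MALL_rule[of "({#({#mGam#}, {#F mphi, F mpsi, mDel#})#}, ({#mGam#}, {#F (Addition mphi mpsi), mDel#}))"
      "\<lambda>x. if x = 0 then A else B" "\<lambda>x. if x = 0 then \<Gamma> else \<Delta>"]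
  by (simp add: inst_def inst_mset_def MALL_def add_mset_commute)

section \<open>Additive rules for the iterated connectives\<close>

lemma bigOr_left:
  assumes "\<forall>A\<in>set As. provable H (add_mset A \<Gamma>, \<Delta>)"
  shows "provable H (add_mset (bigOr As) \<Gamma>, \<Delta>)"
  using assms by (induction As) (auto intro: bot_left or_left)

lemma bigOr_right:
  assumes "A \<in> set As" and "provable H (\<Gamma>, add_mset A \<Delta>)"
  shows "provable H (\<Gamma>, add_mset (bigOr As) \<Delta>)"
  using assms by (induction As) (auto intro: or_right1 or_right2)

lemma bigAnd_left:
  assumes "A \<in> set As" and "provable H (add_mset A \<Gamma>, \<Delta>)"
  shows "provable H (add_mset (bigAnd As) \<Gamma>, \<Delta>)"
  using assms by (induction As) (auto intro: and_left1 and_left2)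

lemma bigAnd_right:
  assumes "\<forall>A\<in>set As. provable H (\<Gamma>, add_mset A \<Delta>)"
  shows "provable H (\<Gamma>, add_mset (bigAnd As) \<Delta>)"
  using assms by (induction As) (auto intro: top_right and_right)

text \<open>The multiplicative reading: the members of the list stand side by side in the succedent.
  In the induction the head waits in \<Delta> while the tail is gathered.\<close>

lemma bigOr_multiplicative_right:
  assumes "provable H (\<Gamma>, mset As + \<Delta>)"
  shows "provable H (\<Gamma>, add_mset (bigOr As) \<Delta>)"
  using assms
proof (induction As arbitrary: \<Delta>)
  case Nil
  then show ?case by (simp add: zero_right)
next
  case (Cons A As)
  from Cons.IH[of "add_mset A \<Delta>"] Cons.prems show ?case
    by (simp add: addition_right add_mset_commute)
qed

lemma bigAnd_multiplicative_left:
  assumes "provable H (mset As + \<Gamma>, \<Delta>)"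
  shows "provable H (add_mset (bigAnd As) \<Gamma>, \<Delta>)"
  using assms
proof (induction As arbitrary: \<Gamma>)
  case Nil
  then show ?case by (simp add: one_left)
next
  case (Cons A As)
  from Cons.IH[of "add_mset A \<Gamma>"] Cons.prems show ?case
    by (simp add: fusion_left add_mset_commute)
qed

text \<open>The list ends in \<open>Bot\<close>, which proves every succedent. So any \<Delta> can
  be added without a weakening rule; later it holds the contexts of components without
  premises.\<close>

lemma bigOr_multiplicative_left:
  assumes "\<forall>i\<in>set is. provable H ({#c i#}, \<Lambda> i)"
  shows "provable H ({#bigOr (map c is)#}, (\<Sum>i\<leftarrow>is. \<Lambda> i) + \<Delta>)"
  using assms
proof (induction "is")
  case Nil
  then show ?case by (simp add: bot_left)
next
  case (Cons i "is")
  then show ?case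
    using addition_left[of "c i" "{#}" "\<Lambda> i" "bigOr (map c is)" "{#}"] by (simp add: add.assoc)
qed

text \<open>Dual use of the final \<open>Top\<close>: it is provable on the right under every
  antecedent, so \<Pi> comes for free.\<close>

lemma bigAnd_multiplicative_right:
  assumes "\<forall>i\<in>set is. provable H (\<Gamma> i, add_mset (c i) (\<Delta> i))"
  shows "provable H ((\<Sum>i\<leftarrow>is. \<Gamma> i) + \<Pi>, add_mset (bigAnd (map c is)) (\<Sum>i\<leftarrow>is. \<Delta> i))"
  using assms
proof (induction "is")
  case Nil
  then show ?case by (simp add: top_right)
next
  case (Cons i "is")
  then show ?case
    using fusion_right[of "\<Gamma> i" "c i" "\<Delta> i"] by (simp add: add.assoc)
qed

text \<open>The summands are exchanged one at a time. At each exchange all others, old or new,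
  belong to the context, so the local replacement must be valid for every \<Delta>.\<close>

lemma right_sum_replace:
  assumes "finite J" and "\<And>j \<Delta>. j \<in> J \<Longrightarrow> provable H (\<Gamma>, A j + \<Delta>) \<Longrightarrow> provable H (\<Gamma>, B j + \<Delta>)"
    and "provable H (\<Gamma>, (\<Sum>j\<in>J. A j) + \<Delta>)"
  shows "provable H (\<Gamma>, (\<Sum>j\<in>J. B j) + \<Delta>)"
  using assms
proof (induction J arbitrary: \<Delta> rule: finite_induct)
  case empty
  then show ?case by simp
next
  case (insert j J)
  have "provable H (\<Gamma>, (\<Sum>j\<in>J. A j) + (A j + \<Delta>))"
    using insert by (simp add: ac_simps)
  then have "provable H (\<Gamma>, (\<Sum>j\<in>J. B j) + (A j + \<Delta>))"
    using insert by blast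
  then have "provable H (\<Gamma>, A j + ((\<Sum>j\<in>J. B j) + \<Delta>))"
    by (simp add: ac_simps)
  then have "provable H (\<Gamma>, B j + ((\<Sum>j\<in>J. B j) + \<Delta>))"
    using insert.prems(1) by blast
  then show ?case
    using insert by (simp add: ac_simps)
qed

lemma bigOr_right_sum:
  assumes "finite J" and "\<And>j. j \<in> J \<Longrightarrow> d j \<in> set (As j)"
    and "provable H (\<Gamma>, (\<Sum>j\<in>J. {#d j#}) + \<Delta>)"
  shows "provable H (\<Gamma>, (\<Sum>j\<in>J. {#bigOr (As j)#}) + \<Delta>)"
  using assms(1) _ assms(3) by (rule right_sum_replace) (simp add: bigOr_right[OF assms(2)])

lemma bigOr_multiplicative_right_sum:
  assumes "finite J" and "provable H (\<Gamma>, (\<Sum>j\<in>J. mset (As j)) + \<Delta>)"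
  shows "provable H (\<Gamma>, (\<Sum>j\<in>J. {#bigOr (As j)#}) + \<Delta>)"
  using assms(1) _ assms(2) by (rule right_sum_replace) (simp add: bigOr_multiplicative_right del: mset_map)

end

section \<open>Splitting multisets\<close>

lemma sum_mset_eq_plus_split:
  fixes \<Delta> :: "nat \<Rightarrow> 'a multiset"
  assumes "(\<Sum>i<n. \<Delta> i) = A + B"
  shows "\<exists>a b. (\<forall>i<n. \<Delta> i = a i + b i) \<and> (\<Sum>i<n. a i) = A \<and> (\<Sum>i<n. b i) = B"
  using assms
proof (induction n arbitrary: A B)
  case 0
  then show ?case by simp
next
  case (Suc n)
  \<comment> \<open>Greedy choice: \<open>X\<close> is the largest part of \<open>\<Delta> n\<close>
    that fits into \<open>A\<close>. The rest fits into \<open>B\<close> because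
    \<open>\<Delta> n\<close> is contained in \<open>A + B\<close>.\<close>
  define X where "X = \<Delta> n \<inter># A"
  define Y where "Y = \<Delta> n - A"
  have XY: "\<Delta> n = X + Y"
    unfolding X_def Y_def by (metis add.commute diff_intersect_left_idem inter_subset_eq_union
      multiset_inter_commute subset_mset.diff_add subset_mset.inf.cobounded1)
  have XA: "X \<subseteq># A" by (simp add: X_def)
  have "\<Delta> n \<subseteq># A + B"
    using Suc.prems by (metis mset_subset_eq_add_right sum.lessThan_Suc)
  then have YB: "Y \<subseteq># B"
    unfolding Y_def by (simp add: add.commute subset_eq_diff_conv)
  from XA YB obtain A' B' where A': "A = X + A'" and B': "B = Y + B'"
    by (auto simp: mset_subset_eq_exists_conv)
  have "(\<Sum>i<n. \<Delta> i) + (X + Y) = (A' + B') + (X + Y)"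
    using Suc.prems by (simp add: XY A' B' ac_simps)
  then have "(\<Sum>i<n. \<Delta> i) = A' + B'"
    by (simp only: add_right_cancel)
  from Suc.IH[OF this] obtain a b where ab: "\<forall>i<n. \<Delta> i = a i + b i"
    "(\<Sum>i<n. a i) = A'" "(\<Sum>i<n. b i) = B'"
    by blast
  show ?case
    by (rule exI[of _ "a(n := X)"], rule exI[of _ "b(n := Y)"])
      (use ab XY A' B' in \<open>auto simp: less_Suc_eq\<close>)
qed

text \<open>The last column of the matrix \<open>L\<close> is split off by the two-part case, and
  the rest follows by induction on \<open>k\<close>. This is the refinement property of free
  commutative monoids.\<close>

lemma sum_mset_eq_sum_refinement:
  fixes \<Delta> \<Lambda> :: "nat \<Rightarrow> 'a multiset"
  assumes "(\<Sum>i<n. \<Delta> i) = (\<Sum>j<k. \<Lambda> j)"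
  obtains L where "\<And>i. i < n \<Longrightarrow> \<Delta> i = (\<Sum>j<k. L i j)" "\<And>j. j < k \<Longrightarrow> \<Lambda> j = (\<Sum>i<n. L i j)"
proof -
  have "\<exists>L. (\<forall>i<n. \<Delta> i = (\<Sum>j<k. L i j)) \<and> (\<forall>j<k. \<Lambda> j = (\<Sum>i<n. L i j))"
    using assms
  proof (induction k arbitrary: \<Delta>)
    case 0
    then show ?case by (simp flip: set_mset_eq_empty_iff add: set_mset_sum)
  next
    case (Suc k)
    then obtain a b where ab: "\<forall>i<n. \<Delta> i = a i + b i" "(\<Sum>i<n. a i) = (\<Sum>j<k. \<Lambda> j)"
      "(\<Sum>i<n. b i) = \<Lambda> k"
      using sum_mset_eq_plus_split[of \<Delta> n "\<Sum>j<k. \<Lambda> j" "\<Lambda> k"] by auto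
    from Suc.IH[OF ab(2)] obtain L where
      L: "\<forall>i<n. a i = (\<Sum>j<k. L i j)" "\<forall>j<k. \<Lambda> j = (\<Sum>i<n. L i j)"
      by blast
    show ?case
      by (rule exI[of _ "\<lambda>i. (L i)(k := b i)"]) (use ab L in \<open>auto simp: less_Suc_eq\<close>)
  qed
  then show thesis using that by blast
qed

text \<open>Different elements may have equal images, so the match is made occurrence by occurrence
  and keeps multiplicities. It will assign to each premise its own subproof.\<close>

lemma image_mset_eq_pairing:
  assumes "image_mset f A = image_mset g B"
  shows "\<exists>T. image_mset fst T = B \<and> image_mset snd T = A \<and> (\<forall>p\<in>#T. f (snd p) = g (fst p))"
  using assms
proof (induction B arbitrary: A)
  case empty
  then show ?case by simp
next
  case (add b B)
  then obtain a A' where A: "A = add_mset a A'" "f a = g b" "image_mset f A' = image_mset g B"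
    by (auto dest!: msed_map_invR)
  from add.IH[OF A(3)] obtain T where "image_mset fst T = B" "image_mset snd T = A'"
    "\<forall>p\<in>#T. f (snd p) = g (fst p)"
    by blast
  then show ?case
    by (intro exI[of _ "add_mset (b, a) T"]) (use A in auto)
qed

text \<open>The pairs for each index are kept in a list because the iterated connectives are formed
  along lists.\<close>

lemma image_mset_eq_sum_pairing:
  assumes "image_mset f A = (\<Sum>i<n::nat. image_mset (g i) (\<Phi> i))"
  shows "\<exists>T. (\<forall>i<n. mset (map fst (T i)) = \<Phi> i \<and> (\<forall>p\<in>set (T i). f (snd p) = g i (fst p)))
    \<and> A = (\<Sum>i<n. mset (map snd (T i)))"
  using assms
proof (induction n arbitrary: A)
  case 0
  then show ?case by simp
next
  case (Suc n)
  then obtain A1 A2 where A: "A = A1 + A2" "image_mset f A1 = (\<Sum>i<n. image_mset (g i) (\<Phi> i))"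
    "image_mset f A2 = image_mset (g n) (\<Phi> n)"
    by (auto dest!: image_mset_eq_plusD)
  from Suc.IH[OF A(2)] obtain T where T: "\<forall>i<n. mset (map fst (T i)) = \<Phi> i \<and>
      (\<forall>p\<in>set (T i). f (snd p) = g i (fst p))" "A1 = (\<Sum>i<n. mset (map snd (T i)))"
    by blast
  from image_mset_eq_pairing[OF A(3)] obtain U where U: "image_mset fst U = \<Phi> n"
    "image_mset snd U = A2" "\<forall>p\<in>#U. f (snd p) = g n (fst p)"
    by blast
  obtain u where u: "mset u = U" using ex_mset by blast
  show ?case
    by (rule exI[of _ "T(n := u)"]) (use T U u A in \<open>auto simp: less_Suc_eq\<close>)
qed

section \<open>Instances of focused rules\<close>

lemma vars_subst:
  "vars (subst \<sigma> A) = (\<Union>v\<in>vars A. case v of At p \<Rightarrow> {p} | FVar x \<Rightarrow> vars (\<sigma> x))"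
  by (induction A) (auto split: mvar.splits)

lemma vars_mset_simps [simp]:
  "vars_mset {#} = {}"
  "vars_mset (add_mset A \<Gamma>) = vars A \<union> vars_mset \<Gamma>"
  "vars_mset (\<Gamma> + \<Delta>) = vars_mset \<Gamma> \<union> vars_mset \<Delta>"
  by (auto simp: vars_mset_def)

lemma vars_mset_sum: "finite I \<Longrightarrow> vars_mset (\<Sum>i\<in>I. \<Gamma> i) = (\<Union>i\<in>I. vars_mset (\<Gamma> i))"
  by (induction I rule: finite_induct) auto

text \<open>The variables of an instance are determined by those of the scheme, so the variable
  condition on focused rules passes to their instances.\<close>

lemma vars_mset_subst_subset:
  assumes "vars_mset X \<subseteq> vars A"
  shows "vars_mset (image_mset (subst \<sigma>) X) \<subseteq> vars (subst \<sigma> A)"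
  using assms by (auto simp: vars_mset_def vars_subst)

lemma inst_mset_simps [simp]:
  "inst_mset \<sigma> \<tau> {#} = {#}"
  "inst_mset \<sigma> \<tau> (add_mset i X) = inst_item \<sigma> \<tau> i + inst_mset \<sigma> \<tau> X"
  "inst_mset \<sigma> \<tau> (X + Y) = inst_mset \<sigma> \<tau> X + inst_mset \<sigma> \<tau> Y"
  by (simp_all add: inst_mset_def)

lemma inst_mset_sum: "inst_mset \<sigma> \<tau> (\<Sum>i\<in>I. X i) = (\<Sum>i\<in>I. inst_mset \<sigma> \<tau> (X i))"
  by (induction I rule: infinite_finite_induct) auto

lemma inst_mset_F [simp]: "inst_mset \<sigma> \<tau> (image_mset F X) = image_mset (subst \<sigma>) X"
  by (induction X) auto

lemma image_mset_sum: "image_mset f (\<Sum>i\<in>I. X i) = (\<Sum>i\<in>I. image_mset f (X i))"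
  by (induction I rule: infinite_finite_induct) auto

lemma distinct_contexts_assignment:
  assumes "distinct_contexts n \<Gamma> \<Delta>"
  obtains \<tau> :: "nat \<Rightarrow> 'a" where "\<And>i. i < n \<Longrightarrow> \<tau> (\<Gamma> i) = g i" "\<And>i. i < n \<Longrightarrow> \<tau> (\<Delta> i) = d i"
proof -
  \<comment> \<open>Injectivity lets the inverses recover the index, and disjointness keeps the two
    branches apart. Values outside both images are arbitrary.\<close>
  define \<tau> where "\<tau> v = (if v \<in> \<Gamma> ` {..<n} then g (inv_into {..<n} \<Gamma> v)
    else d (inv_into {..<n} \<Delta> v))" for v
  have "\<tau> (\<Gamma> i) = g i" if "i < n" for i
    using assms that by (auto simp: \<tau>_def distinct_contexts_def)
  moreover have "\<tau> (\<Delta> i) = d i" if "i < n" for i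
  proof -
    have "\<Delta> i \<notin> \<Gamma> ` {..<n}"
      using assms that by (auto simp: distinct_contexts_def)
    then show ?thesis
      using assms that by (auto simp: \<tau>_def distinct_contexts_def)
  qed
  ultimately show thesis using that by blast
qed

text \<open>The contexts are arguments separate from the active formulas \<open>\<Phi>\<close>, so
  that they can be exchanged while \<open>\<Phi>\<close> stays fixed.\<close>

definition left_premises :: "nat \<Rightarrow> (nat \<Rightarrow> form multiset) \<Rightarrow> (nat \<Rightarrow> form multiset) \<Rightarrow>
    (nat \<Rightarrow> form multiset multiset) \<Rightarrow> sequent multiset" where
  "left_premises n \<Gamma> \<Delta> \<Phi> = (\<Sum>i<n. image_mset (\<lambda>X. (\<Gamma> i + X, \<Delta> i)) (\<Phi> i))"

definition right_premises :: "nat \<Rightarrow> (nat \<Rightarrow> form multiset) \<Rightarrow> (nat \<Rightarrow> form multiset) \<Rightarrow>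
    (nat \<Rightarrow> form multiset multiset) \<Rightarrow> sequent multiset" where
  "right_premises n \<Gamma> \<Delta> \<Phi> = (\<Sum>i<n. image_mset (\<lambda>X. (\<Gamma> i, \<Delta> i + X)) (\<Phi> i))"

text \<open>The contexts of a focused rule are free: keeping the active formulas of an instance and
  replacing its contexts gives another instance.\<close>

lemma left_focused_instanceE:
  assumes "left_focused r" and "instance_of r Ps S"
  obtains n \<Gamma> \<Delta> \<Phi> \<phi> where "\<And>i X. i < n \<Longrightarrow> X \<in># \<Phi> i \<Longrightarrow> vars_mset X \<subseteq> vars \<phi>"
    and "Ps = left_premises n \<Gamma> \<Delta> \<Phi>" and "S = (add_mset \<phi> (\<Sum>i<n. \<Gamma> i), \<Sum>i<n. \<Delta> i)"
    and "\<And>\<Gamma>' \<Delta>'. instance_of r (left_premises n \<Gamma>' \<Delta>' \<Phi>) (add_mset \<phi> (\<Sum>i<n. \<Gamma>' i), \<Sum>i<n. \<Delta>' i)"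
proof -
  from assms(1) obtain n \<gamma> \<delta> \<Psi> \<psi> where d: "distinct_contexts n \<gamma> \<delta>"
    and v: "\<forall>i<n. \<forall>X\<in>#\<Psi> i. vars_mset X \<subseteq> vars \<psi>"
    and r: "r = (\<Sum>i<n. image_mset (\<lambda>X. (add_mset (M (\<gamma> i)) (image_mset F X), {#M (\<delta> i)#})) (\<Psi> i),
          (add_mset (F \<psi>) (\<Sum>i<n. {#M (\<gamma> i)#}), \<Sum>i<n. {#M (\<delta> i)#}))"
    unfolding left_focused_def by blast
  from assms(2) obtain \<sigma> \<tau> where inst: "Ps = image_mset (inst \<sigma> \<tau>) (fst r)" "S = inst \<sigma> \<tau> (snd r)"
    unfolding instance_of_def by blast
  define \<Phi> where "\<Phi> i = image_mset (image_mset (subst \<sigma>)) (\<Psi> i)" for i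
  \<comment> \<open>\<open>\<Phi>\<close> depends on \<sigma> but not on \<rho>. Hence varying
    \<rho> changes only the contexts.\<close>
  have prem: "image_mset (inst \<sigma> \<rho>) (fst r) = left_premises n (\<rho> \<circ> \<gamma>) (\<rho> \<circ> \<delta>) \<Phi>" for \<rho>
    by (simp add: r left_premises_def \<Phi>_def image_mset_sum inst_def multiset.map_comp comp_def)
  have concl: "inst \<sigma> \<rho> (snd r) = (add_mset (subst \<sigma> \<psi>) (\<Sum>i<n. \<rho> (\<gamma> i)), \<Sum>i<n. \<rho> (\<delta> i))" for \<rho>
    by (simp add: r inst_def inst_mset_sum)
  show thesis
  proof (rule that)
    show "vars_mset X \<subseteq> vars (subst \<sigma> \<psi>)" if "i < n" "X \<in># \<Phi> i" for i X
      using that v by (auto simp: \<Phi>_def dest: vars_mset_subst_subset[of _ _ \<sigma>])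
    show "Ps = left_premises n (\<tau> \<circ> \<gamma>) (\<tau> \<circ> \<delta>) \<Phi>"
      by (simp add: inst prem)
    show "S = (add_mset (subst \<sigma> \<psi>) (\<Sum>i<n. (\<tau> \<circ> \<gamma>) i), \<Sum>i<n. (\<tau> \<circ> \<delta>) i)"
      by (simp add: inst concl)
    fix \<Gamma>' \<Delta>' :: "nat \<Rightarrow> form multiset"
    obtain \<rho> where \<rho>: "\<And>i. i < n \<Longrightarrow> \<rho> (\<gamma> i) = \<Gamma>' i" "\<And>i. i < n \<Longrightarrow> \<rho> (\<delta> i) = \<Delta>' i"
      using distinct_contexts_assignment[OF d] by blast
    have "left_premises n \<Gamma>' \<Delta>' \<Phi> = image_mset (inst \<sigma> \<rho>) (fst r)"
      unfolding prem by (simp add: left_premises_def \<rho>)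
    moreover have "(add_mset (subst \<sigma> \<psi>) (\<Sum>i<n. \<Gamma>' i), \<Sum>i<n. \<Delta>' i) = inst \<sigma> \<rho> (snd r)"
      unfolding concl by (simp add: \<rho>)
    ultimately show "instance_of r (left_premises n \<Gamma>' \<Delta>' \<Phi>)
        (add_mset (subst \<sigma> \<psi>) (\<Sum>i<n. \<Gamma>' i), \<Sum>i<n. \<Delta>' i)"
      unfolding instance_of_def by blast
  qed
qed

lemma right_focused_instanceE:
  assumes "right_focused r" and "instance_of r Ps S"
  obtains n \<Gamma> \<Delta> \<Phi> \<phi> where "\<And>i X. i < n \<Longrightarrow> X \<in># \<Phi> i \<Longrightarrow> vars_mset X \<subseteq> vars \<phi>"
    and "Ps = right_premises n \<Gamma> \<Delta> \<Phi>" and "S = (\<Sum>i<n. \<Gamma> i, add_mset \<phi> (\<Sum>i<n. \<Delta> i))"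
    and "\<And>\<Gamma>' \<Delta>'. instance_of r (right_premises n \<Gamma>' \<Delta>' \<Phi>) (\<Sum>i<n. \<Gamma>' i, add_mset \<phi> (\<Sum>i<n. \<Delta>' i))"
proof -
  from assms(1) obtain n \<gamma> \<delta> \<Psi> \<psi> where d: "distinct_contexts n \<gamma> \<delta>"
    and v: "\<forall>i<n. \<forall>X\<in>#\<Psi> i. vars_mset X \<subseteq> vars \<psi>"
    and r: "r = (\<Sum>i<n. image_mset (\<lambda>X. ({#M (\<gamma> i)#}, add_mset (M (\<delta> i)) (image_mset F X))) (\<Psi> i),
          (\<Sum>i<n. {#M (\<gamma> i)#}, add_mset (F \<psi>) (\<Sum>i<n. {#M (\<delta> i)#})))"
    unfolding right_focused_def by blast
  from assms(2) obtain \<sigma> \<tau> where inst: "Ps = image_mset (inst \<sigma> \<tau>) (fst r)" "S = inst \<sigma> \<tau> (snd r)"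
    unfolding instance_of_def by blast
  define \<Phi> where "\<Phi> i = image_mset (image_mset (subst \<sigma>)) (\<Psi> i)" for i
  have prem: "image_mset (inst \<sigma> \<rho>) (fst r) = right_premises n (\<rho> \<circ> \<gamma>) (\<rho> \<circ> \<delta>) \<Phi>" for \<rho>
    by (simp add: r right_premises_def \<Phi>_def image_mset_sum inst_def multiset.map_comp comp_def)
  have concl: "inst \<sigma> \<rho> (snd r) = (\<Sum>i<n. \<rho> (\<gamma> i), add_mset (subst \<sigma> \<psi>) (\<Sum>i<n. \<rho> (\<delta> i)))" for \<rho>
    by (simp add: r inst_def inst_mset_sum)
  show thesis
  proof (rule that)
    show "vars_mset X \<subseteq> vars (subst \<sigma> \<psi>)" if "i < n" "X \<in># \<Phi> i" for i X
      using that v by (auto simp: \<Phi>_def dest: vars_mset_subst_subset[of _ _ \<sigma>])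
    show "Ps = right_premises n (\<tau> \<circ> \<gamma>) (\<tau> \<circ> \<delta>) \<Phi>"
      by (simp add: inst prem)
    show "S = (\<Sum>i<n. (\<tau> \<circ> \<gamma>) i, add_mset (subst \<sigma> \<psi>) (\<Sum>i<n. (\<tau> \<circ> \<delta>) i))"
      by (simp add: inst concl)
    fix \<Gamma>' \<Delta>' :: "nat \<Rightarrow> form multiset"
    obtain \<rho> where \<rho>: "\<And>i. i < n \<Longrightarrow> \<rho> (\<gamma> i) = \<Gamma>' i" "\<And>i. i < n \<Longrightarrow> \<rho> (\<delta> i) = \<Delta>' i"
      using distinct_contexts_assignment[OF d] by blast
    have "right_premises n \<Gamma>' \<Delta>' \<Phi> = image_mset (inst \<sigma> \<rho>) (fst r)"
      unfolding prem by (simp add: right_premises_def \<rho>)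
    moreover have "(\<Sum>i<n. \<Gamma>' i, add_mset (subst \<sigma> \<psi>) (\<Sum>i<n. \<Delta>' i)) = inst \<sigma> \<rho> (snd r)"
      unfolding concl by (simp add: \<rho>)
    ultimately show "instance_of r (right_premises n \<Gamma>' \<Delta>' \<Phi>)
        (\<Sum>i<n. \<Gamma>' i, add_mset (subst \<sigma> \<psi>) (\<Sum>i<n. \<Delta>' i))"
      unfolding instance_of_def by blast
  qed
qed

section \<open>Interpolants across a focused rule\<close>

text \<open>The bound \<open>N\<close> is a parameter rather than a power of a proof size, so that
  bounds can be composed premise by premise.\<close>

definition interpolants ::
    "calculus \<Rightarrow> nat \<Rightarrow> form multiset \<Rightarrow> nat \<Rightarrow> (nat \<Rightarrow> form multiset) \<Rightarrow> (nat \<Rightarrow> form) \<Rightarrow> bool" where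
  "interpolants H N \<Sigma> k \<Lambda> C \<longleftrightarrow> provable H (\<Sigma>, \<Sum>j<k. {#C j#}) \<and>
     (\<forall>j<k. fsize (C j) \<le> N \<and> provable H ({#C j#}, \<Lambda> j) \<and>
        vars (C j) \<subseteq> vars_mset \<Sigma> \<inter> vars_mset (\<Lambda> j) \<and> (monotone_mset \<Sigma> \<longrightarrow> monotone_fm (C j)))"

text \<open>All partitions are quantified because each partition of a conclusion induces its own
  partitions of the premises; this makes the predicate usable as an induction hypothesis.\<close>

definition interpolable :: "calculus \<Rightarrow> nat \<Rightarrow> sequent \<Rightarrow> bool" where
  "interpolable H N S \<longleftrightarrow>
     (\<forall>k \<Lambda>. snd S = (\<Sum>j<k. \<Lambda> j) \<longrightarrow> (\<exists>C. interpolants H N (fst S) k \<Lambda> C))"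

lemma monotone_feasible_interpolation_iff:
  "monotone_feasible_interpolation G H \<longleftrightarrow>
     (\<exists>c. \<forall>\<pi>. is_proof G \<pi> \<longrightarrow> interpolable H (proof_size \<pi> ^ c) (root \<pi>))"
proof -
  have "monotone_feasible_interpolation G H \<longleftrightarrow> (\<exists>c. \<forall>k \<Sigma> \<Lambda> \<pi>.
     is_proof G \<pi> \<and> root \<pi> = (\<Sigma>, \<Sum>j<k. \<Lambda> j) \<longrightarrow>
     (\<exists>C. interpolants H (proof_size \<pi> ^ c) \<Sigma> k \<Lambda> C))"
    unfolding monotone_feasible_interpolation_def interpolants_def ..
  also have "\<dots> \<longleftrightarrow> (\<exists>c. \<forall>\<pi>. is_proof G \<pi> \<longrightarrow> interpolable H (proof_size \<pi> ^ c) (root \<pi>))"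
    unfolding interpolable_def prod_eq_iff fst_conv snd_conv by fast
  finally show ?thesis .
qed

lemma interpolable_mono:
  assumes "interpolable H N S" and "N \<le> N'"
  shows "interpolable H N' S"
proof -
  have "interpolants H N' \<Sigma> k \<Lambda> C" if "interpolants H N \<Sigma> k \<Lambda> C" for \<Sigma> k \<Lambda> C
    using that assms(2) unfolding interpolants_def by (auto intro: order_trans)
  then show ?thesis
    using assms(1) unfolding interpolable_def by fast
qed

section \<open>Sums restricted to the components with premises\<close>

lemma sum_list_filter_upt:
  fixes f :: "nat \<Rightarrow> 'a :: comm_monoid_add"
  shows "(\<Sum>i\<leftarrow>filter P [0..<n]. f i) = (\<Sum>i<n. if P i then f i else 0)"
  by (induction n) (auto simp: ac_simps)

lemma sum_filter_upt_split:
  fixes f :: "nat \<Rightarrow> 'a :: comm_monoid_add"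
  shows "(\<Sum>i<n. f i) = (\<Sum>i\<leftarrow>filter P [0..<n]. f i) + (\<Sum>i<n. if P i then 0 else f i)"
  by (induction n) (auto simp: ac_simps)

lemma mset_map_filter_upt:
  "mset (map f (filter P [0..<n])) = (\<Sum>i<n. if P i then {#f i#} else {#})"
  by (induction n) auto

text \<open>The formulas arise grouped by context \<open>i\<close> and are needed grouped by part
  \<open>j\<close>.\<close>

lemma sum_mset_map_swap:
  "(\<Sum>j\<in>J. mset (map (\<lambda>i. f i j) is)) = (\<Sum>i\<leftarrow>is. \<Sum>j\<in>J. {#f i j#})"
proof (induction "is")
  case Nil
  then show ?case by simp
next
  case (Cons i "is")
  have "(\<Sum>j\<in>J. mset (map (\<lambda>i. f i j) (i # is))) = (\<Sum>j\<in>J. {#f i j#} + mset (map (\<lambda>i. f i j) is))"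
    by simp
  then show ?case
    by (simp only: sum.distrib Cons.IH list.map sum_list.Cons)
qed

text \<open>The leading 1 pays for the unit of the outer combination. Each premise pays for its
  inner connective, and the first premise of a component also pays for the inner unit and the outer
  connective; so 3 per premise is enough.\<close>

lemma nested_size_le:
  fixes N :: "'a \<Rightarrow> nat"
  assumes "\<And>i p. i < n \<Longrightarrow> p \<in> set (T i) \<Longrightarrow> s i p \<le> N p"
  shows "1 + (\<Sum>i\<leftarrow>filter (\<lambda>i. T i \<noteq> []) [0..<n]. (1 + (\<Sum>p\<leftarrow>T i. s i p + 1)) + 1)
    \<le> 1 + (\<Sum>i<n. \<Sum>p\<leftarrow>T i. N p + 3)"
proof -
  have "(1 + (\<Sum>p\<leftarrow>T i. s i p + 1)) + 1 \<le> (\<Sum>p\<leftarrow>T i. N p + 3)" if "i < n" "T i \<noteq> []" for i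
  proof -
    from that obtain q qs where q: "T i = q # qs" by (cases "T i") auto
    have "(\<Sum>p\<leftarrow>qs. s i p + 1) \<le> (\<Sum>p\<leftarrow>qs. N p + 3)"
      by (rule sum_list_mono) (use assms[of i] that q in \<open>auto intro!: add_mono le_SucI\<close>)
    moreover have "s i q \<le> N q" using assms[of i] that q by auto
    ultimately show ?thesis by (simp add: q)
  qed
  then show ?thesis
    unfolding sum_list_filter_upt by (auto intro!: sum_mono)
qed

context MALL_extension
begin

text \<open>Components whose premise list \<open>T i\<close> is empty contribute no summand to the interpolants: their
  number is not bounded by the size of the proof. The unit \<open>Bot\<close> of \<open>bigOr\<close> takes care of their
  contexts.\<close>

lemma interpolable_left_focused:
  fixes T :: "nat \<Rightarrow> (form multiset \<times> 'a) list"
  assumes vars: "\<And>i p. i < n \<Longrightarrow> p \<in> set (T i) \<Longrightarrow> vars_mset (fst p) \<subseteq> vars \<phi>"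
    and mono: "\<And>i p. monotone_mset (add_mset \<phi> (\<Sum>i<n. \<Gamma> i)) \<Longrightarrow> i < n \<Longrightarrow> p \<in> set (T i) \<Longrightarrow>
      monotone_mset (\<Gamma> i + fst p)"
    and rule: "\<And>\<Gamma>' \<Delta>'. (\<And>i p. i < n \<Longrightarrow> p \<in> set (T i) \<Longrightarrow> provable H (\<Gamma>' i + fst p, \<Delta>' i)) \<Longrightarrow>
      provable H (add_mset \<phi> (\<Sum>i<n. \<Gamma>' i), \<Sum>i<n. \<Delta>' i)"
    and prem: "\<And>i p. i < n \<Longrightarrow> p \<in> set (T i) \<Longrightarrow> interpolable H (N p) (\<Gamma> i + fst p, \<Delta> i)"
  shows "interpolable H (1 + (\<Sum>i<n. \<Sum>p\<leftarrow>T i. N p + 3)) (add_mset \<phi> (\<Sum>i<n. \<Gamma> i), \<Sum>i<n. \<Delta> i)"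
  unfolding interpolable_def fst_conv snd_conv
proof (intro allI impI)
  fix k and \<Lambda> :: "nat \<Rightarrow> form multiset"
  assume "(\<Sum>i<n. \<Delta> i) = (\<Sum>j<k. \<Lambda> j)"
  then obtain L where L: "\<And>i. i < n \<Longrightarrow> \<Delta> i = (\<Sum>j<k. L i j)" "\<And>j. j < k \<Longrightarrow> \<Lambda> j = (\<Sum>i<n. L i j)"
    using sum_mset_eq_sum_refinement by blast
  \<comment> \<open>The active formulas are on the left, so row \<open>i\<close> of \<open>L\<close>
    partitions the succedent of every premise with context \<open>i\<close>.\<close>
  have "\<exists>C. interpolants H (N p) (\<Gamma> i + fst p) k (L i) C" if "i < n" "p \<in> set (T i)" for i p
    using prem[OF that] L(1) that by (simp add: interpolable_def)
  then obtain D where D: "\<And>i p. i < n \<Longrightarrow> p \<in> set (T i) \<Longrightarrow>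
      interpolants H (N p) (\<Gamma> i + fst p) k (L i) (D i p)"
    by metis
  define "is" where "is = filter (\<lambda>i. T i \<noteq> []) [0..<n]"
  define B where "B i j = bigOr (map (\<lambda>p. D i p j) (T i))" for i j
  define C where "C j = bigOr (map (\<lambda>i. B i j) is)" for j
  have is_less: "i < n" if "i \<in> set is" for i using that by (auto simp: is_def)
  \<comment> \<open>The rule is reused with the old antecedents and with interpolants as succedents.
    Components without premises receive an empty succedent, on which the rule puts no
    condition.\<close>
  have "provable H (add_mset \<phi> (\<Sum>i<n. \<Gamma> i), \<Sum>i<n. if T i \<noteq> [] then \<Sum>j<k. {#B i j#} else {#})"
  proof (rule rule)
    fix i p assume ip: "i < n" "p \<in> set (T i)"
    then have "provable H (\<Gamma> i + fst p, (\<Sum>j<k. {#D i p j#}) + {#})"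
      using D by (simp add: interpolants_def)
    then have "provable H (\<Gamma> i + fst p, (\<Sum>j<k. {#B i j#}) + {#})"
      unfolding B_def by (rule bigOr_right_sum[rotated 2]) (use ip in auto)
    then show "provable H (\<Gamma> i + fst p, if T i \<noteq> [] then \<Sum>j<k. {#B i j#} else {#})"
      using ip by auto
  qed
  then have "provable H (add_mset \<phi> (\<Sum>i<n. \<Gamma> i), (\<Sum>j<k. mset (map (\<lambda>i. B i j) is)) + {#})"
    by (simp add: sum_mset_map_swap is_def sum_list_filter_upt del: mset_map)
  then have "provable H (add_mset \<phi> (\<Sum>i<n. \<Gamma> i), (\<Sum>j<k. {#C j#}) + {#})"
    unfolding C_def by (rule bigOr_multiplicative_right_sum[rotated]) simp
  moreover have "fsize (C j) \<le> 1 + (\<Sum>i<n. \<Sum>p\<leftarrow>T i. N p + 3)" if "j < k" for j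
    using nested_size_le[of n T "\<lambda>i p. fsize (D i p j)" N] D that
    by (simp add: C_def B_def fsize_bigOr is_def comp_def interpolants_def)
  moreover have "provable H ({#C j#}, \<Lambda> j)" if "j < k" for j
  proof -
    have "provable H ({#B i j#}, L i j)" if "i \<in> set is" for i
      unfolding B_def by (rule bigOr_left) (use D is_less that \<open>j < k\<close> in \<open>auto simp: interpolants_def\<close>)
    \<comment> \<open>The parts \<open>L i j\<close> of components without premises enter as the
      free summand that the final \<open>Bot\<close> allows.\<close>
    then have "provable H ({#C j#}, (\<Sum>i\<leftarrow>is. L i j) + (\<Sum>i<n. if T i \<noteq> [] then {#} else L i j))"
      unfolding C_def by (intro bigOr_multiplicative_left) auto
    then show ?thesis
      using L(2)[OF that] by (simp only: is_def sum_filter_upt_split[of "\<lambda>i. L i j" n "\<lambda>i. T i \<noteq> []"])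
  qed
  moreover have "vars (C j) \<subseteq> vars_mset (add_mset \<phi> (\<Sum>i<n. \<Gamma> i)) \<inter> vars_mset (\<Lambda> j)" if "j < k" for j
  proof -
    have "vars (D i p j) \<subseteq> vars_mset (add_mset \<phi> (\<Sum>i<n. \<Gamma> i)) \<inter> vars_mset (\<Lambda> j)"
      if "i < n" "p \<in> set (T i)" for i p
    proof -
      have "vars (D i p j) \<subseteq> vars_mset (\<Gamma> i + fst p) \<inter> vars_mset (L i j)"
        using D that \<open>j < k\<close> by (simp add: interpolants_def)
      \<comment> \<open>The variables of the active formulas occur in \<phi>, which stands in the
        antecedent of the conclusion.\<close>
      then show ?thesis
        using vars[OF that] that L(2)[OF \<open>j < k\<close>] by (auto simp: vars_mset_sum)
    qed
    then show ?thesis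
      unfolding C_def B_def using is_less by fastforce
  qed
  moreover have "monotone_fm (C j)" if "j < k" "monotone_mset (add_mset \<phi> (\<Sum>i<n. \<Gamma> i))" for j
    using D mono that is_less by (auto simp: C_def B_def interpolants_def)
  ultimately show "\<exists>C. interpolants H (1 + (\<Sum>i<n. \<Sum>p\<leftarrow>T i. N p + 3)) (add_mset \<phi> (\<Sum>i<n. \<Gamma> i)) k \<Lambda> C"
    unfolding interpolants_def by (intro exI[of _ C]) auto
qed

text \<open>The active formulas follow the principal formula \<open>\<phi>\<close> into the component \<open>\<Lambda> m\<close> containing it;
  in this component the interpolants are combined conjunctively, which lets the rule be applied to
  them.\<close>

lemma interpolable_right_focused:
  fixes T :: "nat \<Rightarrow> (form multiset \<times> 'a) list"
  assumes vars: "\<And>i p. i < n \<Longrightarrow> p \<in> set (T i) \<Longrightarrow> vars_mset (fst p) \<subseteq> vars \<phi>"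
    and mono: "\<And>i p. monotone_mset (\<Sum>i<n. \<Gamma> i) \<Longrightarrow> i < n \<Longrightarrow> p \<in> set (T i) \<Longrightarrow> monotone_mset (\<Gamma> i)"
    and rule: "\<And>\<Gamma>' \<Delta>'. (\<And>i p. i < n \<Longrightarrow> p \<in> set (T i) \<Longrightarrow> provable H (\<Gamma>' i, \<Delta>' i + fst p)) \<Longrightarrow>
      provable H (\<Sum>i<n. \<Gamma>' i, add_mset \<phi> (\<Sum>i<n. \<Delta>' i))"
    and prem: "\<And>i p. i < n \<Longrightarrow> p \<in> set (T i) \<Longrightarrow> interpolable H (N p) (\<Gamma> i, \<Delta> i + fst p)"
  shows "interpolable H (1 + (\<Sum>i<n. \<Sum>p\<leftarrow>T i. N p + 3)) (\<Sum>i<n. \<Gamma> i, add_mset \<phi> (\<Sum>i<n. \<Delta> i))"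
  unfolding interpolable_def fst_conv snd_conv
proof (intro allI impI)
  fix k and \<Lambda> :: "nat \<Rightarrow> form multiset"
  assume eq: "add_mset \<phi> (\<Sum>i<n. \<Delta> i) = (\<Sum>j<k. \<Lambda> j)"
  have "\<phi> \<in># (\<Sum>j<k. \<Lambda> j)"
    by (simp flip: eq)
  \<comment> \<open>If several parts contain \<phi>, any of them may serve as
    \<open>m\<close>.\<close>
  then obtain m where m: "m < k" "\<phi> \<in># \<Lambda> m"
    by (auto simp: set_mset_sum)
  define J where "J = {..<k} - {m}"
  have sum_k: "(\<Sum>j<k. f j) = f m + (\<Sum>j\<in>J. f j)" for f :: "nat \<Rightarrow> form multiset"
    unfolding J_def using m by (intro sum.remove) auto
  \<comment> \<open>Removing one occurrence of \<phi> from part \<open>m\<close> leaves a partition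
    of the contexts alone.\<close>
  define \<Lambda>' where "\<Lambda>' = \<Lambda>(m := \<Lambda> m - {#\<phi>#})"
  have \<Lambda>_m: "\<Lambda> m = add_mset \<phi> (\<Lambda>' m)" and \<Lambda>_other: "\<And>j. j \<noteq> m \<Longrightarrow> \<Lambda> j = \<Lambda>' j"
    using m by (auto simp: \<Lambda>'_def)
  have "(\<Sum>j\<in>J. \<Lambda> j) = (\<Sum>j\<in>J. \<Lambda>' j)"
    by (rule sum.cong) (auto simp: J_def \<Lambda>_other)
  then have "(\<Sum>i<n. \<Delta> i) = (\<Sum>j<k. \<Lambda>' j)"
    using eq by (simp add: sum_k \<Lambda>_m)
  then obtain L where L: "\<And>i. i < n \<Longrightarrow> \<Delta> i = (\<Sum>j<k. L i j)" "\<And>j. j < k \<Longrightarrow> \<Lambda>' j = (\<Sum>i<n. L i j)"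
    using sum_mset_eq_sum_refinement by blast
  have "\<exists>C. interpolants H (N p) (\<Gamma> i) k ((L i)(m := L i m + fst p)) C"
    if "i < n" "p \<in> set (T i)" for i p
  proof -
    have "(\<Sum>j\<in>J. ((L i)(m := L i m + fst p)) j) = (\<Sum>j\<in>J. L i j)"
      by (rule sum.cong) (auto simp: J_def)
    then have "\<Delta> i + fst p = (\<Sum>j<k. ((L i)(m := L i m + fst p)) j)"
      using L(1)[OF that(1)] by (simp add: sum_k)
    then show ?thesis
      using prem[OF that] unfolding interpolable_def by simp
  qed
  then obtain D where D: "\<And>i p. i < n \<Longrightarrow> p \<in> set (T i) \<Longrightarrow>
      interpolants H (N p) (\<Gamma> i) k ((L i)(m := L i m + fst p)) (D i p)"
    by metis
  have D_m: "provable H ({#D i p m#}, L i m + fst p)" if "i < n" "p \<in> set (T i)" for i p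
    using D[OF that] m unfolding interpolants_def by (metis fun_upd_same)
  have D_other: "provable H ({#D i p j#}, L i j)" if "i < n" "p \<in> set (T i)" "j < k" "j \<noteq> m" for i p j
    using D[OF that(1,2)] that unfolding interpolants_def by (metis fun_upd_other)
  define "is" where "is = filter (\<lambda>i. T i \<noteq> []) [0..<n]"
  define A where "A i = bigAnd (map (\<lambda>p. D i p m) (T i))" for i
  define B where "B i j = bigOr (map (\<lambda>p. D i p j) (T i))" for i j
  define C where "C j = (if j = m then bigAnd (map A is) else bigOr (map (\<lambda>i. B i j) is))" for j
  have is_less: "i < n" if "i \<in> set is" for i using that by (auto simp: is_def)
  \<comment> \<open>This sequent is obtained without the rule. Premises with context
    \<open>i\<close> share the antecedent \<open>\<Gamma> i\<close>; once their other interpolants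
    are weakened to the common \<open>B i j\<close>, those for \<open>m\<close> are conjoined. For
    an empty \<open>T i\<close> the conjunction is \<open>Top\<close>.\<close>
  have "provable H (\<Gamma> i, add_mset (A i) (\<Sum>j\<in>J. {#B i j#}))" if "i < n" for i
    unfolding A_def
  proof (rule bigAnd_right, clarsimp)
    fix X q assume p: "(X, q) \<in> set (T i)"
    then have "provable H (\<Gamma> i, (\<Sum>j\<in>J. {#D i (X, q) j#}) + {#D i (X, q) m#})"
      using D[OF that p] by (simp add: interpolants_def sum_k)
    then have "provable H (\<Gamma> i, (\<Sum>j\<in>J. {#B i j#}) + {#D i (X, q) m#})"
      unfolding B_def by (rule bigOr_right_sum[rotated 2]) (use p in \<open>auto simp: J_def\<close>)
    then show "provable H (\<Gamma> i, add_mset (D i (X, q) m) (\<Sum>j\<in>J. {#B i j#}))"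
      by simp
  qed
  \<comment> \<open>The antecedents \<open>\<Gamma> i\<close> of components without premises are
    absorbed by the final \<open>Top\<close>.\<close>
  then have "provable H ((\<Sum>i\<leftarrow>is. \<Gamma> i) + (\<Sum>i<n. if T i \<noteq> [] then {#} else \<Gamma> i),
      add_mset (bigAnd (map A is)) (\<Sum>i\<leftarrow>is. \<Sum>j\<in>J. {#B i j#}))"
    using is_less by (intro bigAnd_multiplicative_right) auto
  then have "provable H (\<Sum>i<n. \<Gamma> i, (\<Sum>j\<in>J. mset (map (\<lambda>i. B i j) is)) + {#C m#})"
    by (simp add: is_def sum_filter_upt_split[of \<Gamma> n "\<lambda>i. T i \<noteq> []"] sum_mset_map_swap J_def C_def del: mset_map)
  then have "provable H (\<Sum>i<n. \<Gamma> i, (\<Sum>j\<in>J. {#bigOr (map (\<lambda>i. B i j) is)#}) + {#C m#})"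
    by (rule bigOr_multiplicative_right_sum[rotated]) (simp add: J_def)
  moreover have "(\<Sum>j\<in>J. {#bigOr (map (\<lambda>i. B i j) is)#}) = (\<Sum>j\<in>J. {#C j#})"
    by (rule sum.cong) (auto simp: J_def C_def)
  ultimately have "provable H (\<Sum>i<n. \<Gamma> i, \<Sum>j<k. {#C j#})"
    by (simp add: sum_k)
  moreover have "fsize (C j) \<le> 1 + (\<Sum>i<n. \<Sum>p\<leftarrow>T i. N p + 3)" if "j < k" for j
    using nested_size_le[of n T "\<lambda>i p. fsize (D i p j)" N] D that
    by (cases "j = m") (simp_all add: C_def A_def B_def fsize_bigOr fsize_bigAnd is_def comp_def interpolants_def)
  moreover have "provable H ({#C j#}, \<Lambda> j)" if "j < k" for j
  proof (cases "j = m")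
    case True
    \<comment> \<open>Here the rule is used: the antecedents are the \<open>A i\<close>, empty where
      there are no premises, and the succedents are the \<open>L i m\<close>, so that the conclusion
      reproduces \<open>\<Lambda> m\<close>.\<close>
    have "provable H (\<Sum>i<n. if T i \<noteq> [] then {#A i#} else {#}, add_mset \<phi> (\<Sum>i<n. L i m))"
    proof (rule rule)
      fix i p assume ip: "i < n" "p \<in> set (T i)"
      then have "provable H ({#A i#}, L i m + fst p)"
        unfolding A_def by (intro bigAnd_left[OF _ D_m]) auto
      then show "provable H (if T i \<noteq> [] then {#A i#} else {#}, L i m + fst p)"
        using ip by auto
    qed
    then have "provable H (mset (map A is) + {#}, \<Lambda> m)"
      using m by (simp add: is_def mset_map_filter_upt \<Lambda>_m L(2) del: mset_map)
    then show ?thesis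
      using True by (simp add: C_def bigAnd_multiplicative_left del: mset_map)
  next
    case False
    have "provable H ({#B i j#}, L i j)" if "i \<in> set is" for i
      unfolding B_def by (rule bigOr_left) (use D_other is_less that \<open>j < k\<close> False in auto)
    then have "provable H ({#C j#}, (\<Sum>i\<leftarrow>is. L i j) + (\<Sum>i<n. if T i \<noteq> [] then {#} else L i j))"
      using False by (simp add: C_def bigOr_multiplicative_left)
    then show ?thesis
      using L(2)[OF that] \<Lambda>_other[OF False]
      by (simp only: is_def sum_filter_upt_split[of "\<lambda>i. L i j" n "\<lambda>i. T i \<noteq> []"])
  qed
  moreover have "vars (C j) \<subseteq> vars_mset (\<Sum>i<n. \<Gamma> i) \<inter> vars_mset (\<Lambda> j)" if "j < k" for j
  proof -
    have "vars (D i p j) \<subseteq> vars_mset (\<Sum>i<n. \<Gamma> i) \<inter> vars_mset (\<Lambda> j)"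
      if "i < n" "p \<in> set (T i)" for i p
    proof -
      have "vars (D i p j) \<subseteq> vars_mset (\<Gamma> i) \<inter> vars_mset (((L i)(m := L i m + fst p)) j)"
        using D[OF that] \<open>j < k\<close> unfolding interpolants_def by blast
      \<comment> \<open>For part \<open>m\<close> the variables of the active formulas are covered
        by \<phi>, which lies in \<open>\<Lambda> m\<close>.\<close>
      then show ?thesis
        using vars[OF that] that L(2)[OF \<open>j < k\<close>] \<Lambda>_m \<Lambda>_other[of j]
        by (cases "j = m") (auto simp: vars_mset_sum)
    qed
    then show ?thesis
      unfolding C_def A_def B_def using is_less by (fastforce split: if_splits)
  qed
  moreover have "monotone_fm (C j)" if "j < k" "monotone_mset (\<Sum>i<n. \<Gamma> i)" for j
    using D mono that is_less by (auto simp: C_def A_def B_def interpolants_def)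
  ultimately show "\<exists>C. interpolants H (1 + (\<Sum>i<n. \<Sum>p\<leftarrow>T i. N p + 3)) (\<Sum>i<n. \<Gamma> i) k \<Lambda> C"
    unfolding interpolants_def by (intro exI[of _ C]) auto
qed

end

section \<open>Induction on proofs\<close>

lemma proof_size_pos: "0 < proof_size t"
  by (cases t) (simp add: seq_size_def)

text \<open>Apart from the constant 1, the expansions of the two powers on the left have no common
  terms, and all their terms occur on the right. The \<open>+ 1\<close> accounts for the constant
  counted twice.\<close>

lemma power_superadditive:
  fixes x y :: nat
  assumes "0 < c"
  shows "(1 + x) ^ c + (1 + y) ^ c \<le> (1 + x + y) ^ c + 1"
  using assms
proof (induction c rule: nat_induct_non_zero)
  case 1
  then show ?case by simp
next
  case (Suc c)
  let ?a = "(1 + x) ^ c" and ?b = "(1 + y) ^ c" and ?s = "(1 + x + y) ^ c"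
  have "?a \<ge> 1" "?b \<ge> 1" by simp_all
  \<comment> \<open>These cross terms of the product cover the surplus \<open>x + y\<close> left by
    the \<open>+ 1\<close> in the induction hypothesis.\<close>
  then have "x * 1 + y * 1 \<le> x * ?b + y * ?a"
    by (intro add_mono mult_le_mono) simp_all
  moreover have "(1 + x + y) * (?a + ?b) \<le> (1 + x + y) * (?s + 1)"
    using Suc.IH by (rule mult_le_mono2)
  ultimately show ?case by (simp add: algebra_simps)
qed

text \<open>The gap of 4 is 3 for the overhead of one premise and 1 for the loss in
  \<open>power_superadditive\<close>. For \<open>c = 3\<close> the difference is at least 7;
  exponent 2 would fail at \<open>x = 1\<close>.\<close>

lemma cube_gap:
  fixes x :: nat
  assumes "0 < x" and "3 \<le> c"
  shows "x ^ c + 4 \<le> (1 + x) ^ c"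
  using assms(2)
proof (induction c rule: dec_induct)
  case base
  have "x ^ 3 + 3 * x ^ 2 + 3 * x + 1 = (1 + x) ^ 3"
    by (simp add: power3_eq_cube power2_eq_square algebra_simps)
  moreover have "1 \<le> x ^ 2" using assms(1) by simp
  ultimately show ?case using assms(1) by linarith
next
  case (step c)
  have "x ^ Suc c + 4 \<le> (1 + x) * (x ^ c + 4)"
    by (simp add: algebra_simps)
  also have "\<dots> \<le> (1 + x) ^ Suc c"
    unfolding power_Suc using step.IH by (rule mult_le_mono2)
  finally show ?case .
qed

text \<open>The exponent has to absorb the overhead of three symbols per premise.\<close>

lemma sum_powers_le:
  assumes "3 \<le> c" and "\<forall>x\<in>set xs. 0 < x"
  shows "1 + (\<Sum>x\<leftarrow>xs. x ^ c + 3) \<le> (1 + sum_list xs :: nat) ^ c"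
  using assms(2)
proof (induction xs)
  case Nil
  then show ?case by simp
next
  case (Cons x xs)
  have "x ^ c + 4 \<le> (1 + x) ^ c"
    using cube_gap[of x c] assms(1) Cons.prems by simp
  moreover have "1 + (\<Sum>x\<leftarrow>xs. x ^ c + 3) \<le> (1 + sum_list xs) ^ c"
    using Cons by simp
  moreover have "(1 + x) ^ c + (1 + sum_list xs) ^ c \<le> (1 + x + sum_list xs) ^ c + 1"
    using assms(1) by (intro power_superadditive) simp
  ultimately show ?case by (simp add: add.assoc)
qed

text \<open>This allows the rules of \<open>R\<close> to be reused on sequents built from
  interpolants, outside the given proof.\<close>

lemma provable_ext_rule:
  assumes "r \<in> R" and "instance_of r Ps S" and "\<forall>P\<in>#Ps. provable (AxExt G R) P"
  shows "provable (AxExt G R) S"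
proof -
  from assms(3) obtain f where f: "\<forall>P\<in>#Ps. is_proof (AxExt G R) (f P) \<and> root (f P) = P"
    unfolding provable_def by metis
  obtain ps where ps: "mset ps = Ps" using ex_mset by blast
  have "map root (map f ps) = ps"
    using f ps by (auto intro: map_idI)
  then have "is_proof (AxExt G R) (Node S (map f ps))"
    using assms ps f by (intro is_proof.ext_rule[of r]) auto
  then show ?thesis
    unfolding provable_def by (metis ptree.sel(1))
qed

text \<open>Once the pairing lemmas have sorted the subproofs by context, the inference has the
  shape of the two lemmas on focused rules, with a subproof as second component of each
  pair.\<close>

lemma interpolable_MPF:
  assumes ext: "extends (AxExt G R) MALL" and r: "r \<in> R" "MPF r"
    and inst: "instance_of r (mset (map root ts)) S"
    and ts: "\<forall>t\<in>set ts. interpolable (AxExt G R) (N t) (root t)"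
  shows "interpolable (AxExt G R) (1 + (\<Sum>t\<leftarrow>ts. N t + 3)) S"
proof -
  interpret MALL_extension "AxExt G R" by standard (rule ext)
  \<comment> \<open>MPF is applied to the given instance only; the instances with exchanged contexts
    serve provability.\<close>
  have mono: "monotone_mset (fst P)" if "monotone_mset (fst S)" "P \<in># mset (map root ts)" for P
    using r(2) inst that unfolding MPF_def by blast
  have sum_ts: "(\<Sum>t\<leftarrow>ts. N t + 3) = (\<Sum>i<n. \<Sum>p\<leftarrow>T i. N (snd p) + 3)"
    if "mset ts = (\<Sum>i<n. mset (map snd (T i)))" for n and T :: "nat \<Rightarrow> (form multiset \<times> ptree) list"
  proof -
    have sum_list_mset: "(\<Sum>t\<in>#mset xs. N t + 3) = (\<Sum>t\<leftarrow>xs. N t + 3)" for xs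
      by (metis mset_map sum_mset_sum_list)
    have "(\<Sum>t\<leftarrow>ts. N t + 3) = (\<Sum>t\<in>#mset ts. N t + 3)"
      by (simp only: sum_list_mset)
    also have "\<dots> = (\<Sum>i<n. \<Sum>t\<in>#mset (map snd (T i)). N t + 3)"
      unfolding that by (induction n) auto
    also have "\<dots> = (\<Sum>i<n. \<Sum>p\<leftarrow>T i. N (snd p) + 3)"
      by (rule sum.cong) (simp_all only: sum_list_mset map_map comp_def)
    finally show ?thesis .
  qed
  from r(2) consider "left_focused r" | "right_focused r"
    unfolding MPF_def focused_def by blast
  then show ?thesis
  proof cases
    case 1
    then obtain n \<Gamma> \<Delta> \<Phi> \<phi> where vars: "\<And>i X. i < n \<Longrightarrow> X \<in># \<Phi> i \<Longrightarrow> vars_mset X \<subseteq> vars \<phi>"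
      and Ps: "mset (map root ts) = left_premises n \<Gamma> \<Delta> \<Phi>"
      and S: "S = (add_mset \<phi> (\<Sum>i<n. \<Gamma> i), \<Sum>i<n. \<Delta> i)"
      and any: "\<And>\<Gamma>' \<Delta>'. instance_of r (left_premises n \<Gamma>' \<Delta>' \<Phi>)
        (add_mset \<phi> (\<Sum>i<n. \<Gamma>' i), \<Sum>i<n. \<Delta>' i)"
      using inst by (rule left_focused_instanceE) blast
    have "image_mset root (mset ts) = (\<Sum>i<n. image_mset (\<lambda>X. (\<Gamma> i + X, \<Delta> i)) (\<Phi> i))"
      using Ps by (simp add: left_premises_def)
    from image_mset_eq_sum_pairing[OF this] obtain T where
      T: "\<And>i. i < n \<Longrightarrow> mset (map fst (T i)) = \<Phi> i"
        "\<And>i p. i < n \<Longrightarrow> p \<in> set (T i) \<Longrightarrow> root (snd p) = (\<Gamma> i + fst p, \<Delta> i)"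
        "mset ts = (\<Sum>i<n. mset (map snd (T i)))"
      by blast
    have \<Phi>: "set_mset (\<Phi> i) = fst ` set (T i)" if "i < n" for i
      by (metis T(1)[OF that] list.set_map set_mset_mset)
    have snd_ts: "snd p \<in> set ts" if "i < n" "p \<in> set (T i)" for i p
    proof -
      have "snd p \<in># mset ts" unfolding T(3) using that by (auto simp: set_mset_sum)
      then show ?thesis by simp
    qed
    show ?thesis
      unfolding sum_ts[OF T(3)] S
    proof (rule interpolable_left_focused)
      fix i p assume ip: "i < n" "p \<in> set (T i)"
      show "vars_mset (fst p) \<subseteq> vars \<phi>" using vars \<Phi> ip by auto
      show "interpolable (AxExt G R) (N (snd p)) (\<Gamma> i + fst p, \<Delta> i)"
        using ts snd_ts[OF ip] T(2)[OF ip] by metis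
      show "monotone_mset (\<Gamma> i + fst p)" if "monotone_mset (add_mset \<phi> (\<Sum>i<n. \<Gamma> i))"
        using mono[of "root (snd p)"] that snd_ts[OF ip] T(2)[OF ip] by (simp add: S rev_image_eqI)
    next
      fix \<Gamma>' \<Delta>' :: "nat \<Rightarrow> form multiset"
      assume "\<And>i p. i < n \<Longrightarrow> p \<in> set (T i) \<Longrightarrow> provable (AxExt G R) (\<Gamma>' i + fst p, \<Delta>' i)"
      then show "provable (AxExt G R) (add_mset \<phi> (\<Sum>i<n. \<Gamma>' i), \<Sum>i<n. \<Delta>' i)"
        by (intro provable_ext_rule[OF r(1) any]) (auto simp: left_premises_def set_mset_sum \<Phi>)
    qed
  next
    case 2
    then obtain n \<Gamma> \<Delta> \<Phi> \<phi> where vars: "\<And>i X. i < n \<Longrightarrow> X \<in># \<Phi> i \<Longrightarrow> vars_mset X \<subseteq> vars \<phi>"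
      and Ps: "mset (map root ts) = right_premises n \<Gamma> \<Delta> \<Phi>"
      and S: "S = (\<Sum>i<n. \<Gamma> i, add_mset \<phi> (\<Sum>i<n. \<Delta> i))"
      and any: "\<And>\<Gamma>' \<Delta>'. instance_of r (right_premises n \<Gamma>' \<Delta>' \<Phi>)
        (\<Sum>i<n. \<Gamma>' i, add_mset \<phi> (\<Sum>i<n. \<Delta>' i))"
      using inst by (rule right_focused_instanceE) blast
    have "image_mset root (mset ts) = (\<Sum>i<n. image_mset (\<lambda>X. (\<Gamma> i, \<Delta> i + X)) (\<Phi> i))"
      using Ps by (simp add: right_premises_def)
    from image_mset_eq_sum_pairing[OF this] obtain T where
      T: "\<And>i. i < n \<Longrightarrow> mset (map fst (T i)) = \<Phi> i"
        "\<And>i p. i < n \<Longrightarrow> p \<in> set (T i) \<Longrightarrow> root (snd p) = (\<Gamma> i, \<Delta> i + fst p)"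
        "mset ts = (\<Sum>i<n. mset (map snd (T i)))"
      by blast
    have \<Phi>: "set_mset (\<Phi> i) = fst ` set (T i)" if "i < n" for i
      by (metis T(1)[OF that] list.set_map set_mset_mset)
    have snd_ts: "snd p \<in> set ts" if "i < n" "p \<in> set (T i)" for i p
    proof -
      have "snd p \<in># mset ts" unfolding T(3) using that by (auto simp: set_mset_sum)
      then show ?thesis by simp
    qed
    show ?thesis
      unfolding sum_ts[OF T(3)] S
    proof (rule interpolable_right_focused)
      fix i p assume ip: "i < n" "p \<in> set (T i)"
      show "vars_mset (fst p) \<subseteq> vars \<phi>" using vars \<Phi> ip by auto
      show "interpolable (AxExt G R) (N (snd p)) (\<Gamma> i, \<Delta> i + fst p)"
        using ts snd_ts[OF ip] T(2)[OF ip] by metis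
      show "monotone_mset (\<Gamma> i)" if "monotone_mset (\<Sum>i<n. \<Gamma> i)"
        using mono[of "root (snd p)"] that snd_ts[OF ip] T(2)[OF ip] by (simp add: S rev_image_eqI)
    next
      fix \<Gamma>' \<Delta>' :: "nat \<Rightarrow> form multiset"
      assume "\<And>i p. i < n \<Longrightarrow> p \<in> set (T i) \<Longrightarrow> provable (AxExt G R) (\<Gamma>' i, \<Delta>' i + fst p)"
      then show "provable (AxExt G R) (\<Sum>i<n. \<Gamma>' i, add_mset \<phi> (\<Sum>i<n. \<Delta>' i))"
        by (intro provable_ext_rule[OF r(1) any]) (auto simp: right_premises_def set_mset_sum \<Phi>)
    qed
  qed
qed

theorem theorem5p13:
  fixes G H :: calculus and R :: "rule set"
  assumes "extends H MALL"
    and "axiomatic_extension H G R"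
    and "\<forall>r\<in>R. MPF r"
    and "monotone_feasible_interpolation G H"
  shows "monotone_feasible_interpolation H H"
proof -
  have H: "H = AxExt G R"
    using assms(2) by (simp add: axiomatic_extension_def)
  from assms(4) obtain c where c: "\<And>\<pi>. is_proof G \<pi> \<Longrightarrow> interpolable H (proof_size \<pi> ^ c) (root \<pi>)"
    unfolding monotone_feasible_interpolation_iff by blast
  \<comment> \<open>\<open>c\<close> bounds the interpolants of axioms, and an exponent of at least
    3 absorbs the overhead of the rules.\<close>
  define d where "d = max c 3"
  have "interpolable H (proof_size \<pi> ^ d) (root \<pi>)" if "is_proof H \<pi>" for \<pi>
    using that
  \<comment> \<open>Induction on the tree rather than on \<open>is_proof\<close>, whose calculus
    argument changes when an axiom is entered.\<close>
  proof (induction \<pi> rule: ptree.induct)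
    case (Node S ts)
    from Node.prems consider "is_proof G (Node S ts)"
      | r where "r \<in> R" "instance_of r (mset (map root ts)) S" "\<forall>t\<in>set ts. is_proof H t"
      unfolding H by (cases rule: is_proof.cases) auto
    then show ?case
    proof cases
      case 1
      \<comment> \<open>An axiom brings its whole \<open>G\<close>-proof along, so the bound from
        \<open>G\<close> refers to the size of this same tree.\<close>
      show ?thesis
      proof (rule interpolable_mono[OF c[OF 1]])
        show "proof_size (Node S ts) ^ c \<le> proof_size (Node S ts) ^ d"
          using proof_size_pos[of "Node S ts"] by (intro power_increasing) (auto simp: d_def)
      qed
    next
      case 2
      have "interpolable H (1 + (\<Sum>t\<leftarrow>ts. proof_size t ^ d + 3)) S"
        unfolding H
        by (rule interpolable_MPF) (use assms(1,3) 2 Node.IH H in auto)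
      moreover have "1 + (\<Sum>t\<leftarrow>ts. proof_size t ^ d + 3) \<le> proof_size (Node S ts) ^ d"
      proof -
        have "1 + (\<Sum>x\<leftarrow>map proof_size ts. x ^ d + 3) \<le> (1 + sum_list (map proof_size ts)) ^ d"
          by (rule sum_powers_le) (auto simp: d_def proof_size_pos)
        \<comment> \<open>The end sequent has size at least 1, which supplies the summand
          \<open>1 +\<close>.\<close>
        also have "\<dots> \<le> proof_size (Node S ts) ^ d"
          by (intro power_mono) (auto simp: seq_size_def)
        finally show ?thesis by (simp add: comp_def)
      qed
      ultimately show ?thesis
        using interpolable_mono by simp
    qed
  qed
  then show ?thesis
    unfolding monotone_feasible_interpolation_iff by blast
qed

end
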